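(* Let $G$ be a finite group, let $N < M$ be normal subgroups of $G$ (with $N$ properly contained in $M$), and let $g \in M \setminus N$. Then $g^G = M \setminus N$ if and only if every character in $\mathrm{Irr}(G/N)$ is constant on $(M/N) \setminus \{N\}$ (the set of nonidentity elements of $M/N$) and every character in $\mathrm{Irr}(G \mid N)$ vanishes on $g$.
   Context: All groups are finite and characters are complex. $g^G$ denotes the conjugacy class of $g$ in $G$. $\mathrm{Irr}(G)$ is the set of irreducible complex characters of $G$; for a normal subgroup $N$ of $G$, $\mathrm{Irr}(G\mid N)$ is the set of $\chi\in\mathrm{Irr}(G)$ whose kernel does not contain $N$. Irreducible characters of $G/N$ are identified by inflation with the characters in $\mathrm{Irr}(G)$ whose kernel contains $N$. *)

theory Defs
  imports "HOL-Algebra.Coset" "Jordan_Normal_Form.VS_Connect"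
begin

definition conjugacy_class :: "('a, 'b) monoid_scheme \<Rightarrow> 'a \<Rightarrow> 'a set" where
  "conjugacy_class G g = {x \<otimes>\<^bsub>G\<^esub> g \<otimes>\<^bsub>G\<^esub> inv\<^bsub>G\<^esub> x | x. x \<in> carrier G}"

definition mat_trace :: "complex mat \<Rightarrow> complex" where
  "mat_trace A = (\<Sum>i<dim_row A. A $$ (i, i))"

definition representation ::
    "('a, 'b) monoid_scheme \<Rightarrow> nat \<Rightarrow> ('a \<Rightarrow> complex mat) \<Rightarrow> bool" where
  "representation G n \<rho> \<longleftrightarrow> \<rho> \<in> hom G (units_of (ring_mat TYPE(complex) n ()))"

definition irreducible_representation ::
    "('a, 'b) monoid_scheme \<Rightarrow> nat \<Rightarrow> ('a \<Rightarrow> complex mat) \<Rightarrow> bool" where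
  "irreducible_representation G n \<rho> \<longleftrightarrow>
     representation G n \<rho> \<and> n > 0 \<and>
     (\<forall>W. VectorSpace.subspace class_ring W (module_vec TYPE(complex) n) \<longrightarrow>
          (\<forall>x\<in>carrier G. \<forall>w\<in>W. \<rho> x *\<^sub>v w \<in> W) \<longrightarrow>
          W = {0\<^sub>v n} \<or> W = carrier_vec n)"

text \<open>Characters are functions on the carrier only; \<open>restrict\<close> fixes their values elsewhere,
  so that equality of elements of \<open>Irr G\<close> is equality of functions on the group.\<close>

definition character_of ::
    "('a, 'b) monoid_scheme \<Rightarrow> ('a \<Rightarrow> complex mat) \<Rightarrow> 'a \<Rightarrow> complex" where
  "character_of G \<rho> = restrict (\<lambda>x. mat_trace (\<rho> x)) (carrier G)"

definition Irr :: "('a, 'b) monoid_scheme \<Rightarrow> ('a \<Rightarrow> complex) set" where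
  "Irr G = {character_of G \<rho> | n \<rho>. irreducible_representation G n \<rho>}"

definition character_kernel :: "('a, 'b) monoid_scheme \<Rightarrow> ('a \<Rightarrow> complex) \<Rightarrow> 'a set" where
  "character_kernel G \<chi> = {x \<in> carrier G. \<chi> x = \<chi> \<one>\<^bsub>G\<^esub>}"

definition Irr_over :: "('a, 'b) monoid_scheme \<Rightarrow> 'a set \<Rightarrow> ('a \<Rightarrow> complex) set" where
  "Irr_over G N = {\<chi> \<in> Irr G. \<not> N \<subseteq> character_kernel G \<chi>}"

end

theory Submission
  imports Defs "Jordan_Normal_Form.DL_Rank" "Jordan_Normal_Form.Spectral_Radius"
begin

text \<open>
  The theorem rests on counting conjugators by characters. There is a list of irreducible
  characters of \<open>G\<close>, possibly with repetitions, such that for all \<open>g, h\<close>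
    \<open>|{x. x g x\<inverse> = h}| = \<Sum>\<chi>. \<chi>(g) \<chi>(h\<inverse>) / \<chi>(1)\<close>
  (\<open>count_conjugators\<close>). The list consists of the characters of the composition factors of the
  regular representation, and the formula is a version of column orthogonality in which each
  irreducible character occurs as often as its degree. It follows from two facts. The regular character is
  \<open>|G|\<close> at \<open>1\<close> and \<open>0\<close> elsewhere, so summing it over all \<open>x g x\<inverse> h\<inverse>\<close> counts conjugators; and
  by Schur's lemma, for \<open>\<rho>\<close> irreducible with character \<open>\<chi>\<close>, the average of \<open>\<rho>(x g x\<inverse>)\<close> over \<open>x\<close> is the scalar \<open>\<chi>(g) / \<chi>(1)\<close>
  (\<open>Irr_sum_conjugates\<close>).

  The second ingredient is a dichotomy for a normal subgroup \<open>N\<close>: the vectors fixed by \<open>N\<close> form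
  an invariant subspace, so an irreducible representation is either trivial on \<open>N\<close>, or
  \<open>\<Sum>m\<in>N. \<rho>(m) = 0\<close> (\<open>irreducible_trivial_or_sum_zero\<close>). In the first case the character comes
  from \<open>G/N\<close> (\<open>Irr_deflate\<close>); in the second it belongs to \<open>Irr(G | N)\<close> and its values on every
  coset of \<open>N\<close> sum to zero (\<open>Irr_sum_coset\<close>).

  Suppose the class of \<open>g\<close> is \<open>M - N\<close>. Nonidentity elements of \<open>M/N\<close> are then conjugate in \<open>G/N\<close>,
  so characters of \<open>G/N\<close> are constant on them. A character in \<open>Irr(G | N)\<close> is constant on
  \<open>gN \<subseteq> M - N\<close> and sums to zero there, hence vanishes at \<open>g\<close>.

  Conversely let \<open>h \<in> M - N\<close>. In the formula the characters in \<open>Irr(G | N)\<close> contribute nothing,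
  since \<open>\<chi>(g) = 0\<close>. The others come from \<open>G/N\<close> and take the same value at \<open>h\<inverse>\<close> and \<open>g\<inverse>\<close>, which
  both lie in \<open>M - N\<close>. So as many \<open>x\<close> conjugate \<open>g\<close> to \<open>h\<close> as conjugate \<open>g\<close> to itself; the
  latter number is positive, and \<open>h\<close> lies in the class of \<open>g\<close>.
\<close>

section \<open>Sums and traces of matrices\<close>

text \<open>The matrices of all sizes form one type, which has no zero to start a sum from; hence the
  size as a parameter and the entrywise definition.\<close>

definition sum_mats :: "nat \<Rightarrow> ('b \<Rightarrow> complex mat) \<Rightarrow> 'b set \<Rightarrow> complex mat" where
  "sum_mats n f S = mat n n (\<lambda>(i, j). \<Sum>x\<in>S. f x $$ (i, j))"

lemma sum_mats_carrier [simp]: "sum_mats n f S \<in> carrier_mat n n"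
  by (simp add: sum_mats_def)

lemma sum_mats_cong: "(\<And>x. x \<in> S \<Longrightarrow> f x = f' x) \<Longrightarrow> sum_mats n f S = sum_mats n f' S"
  by (simp add: sum_mats_def)

lemma sum_mats_reindex:
  "bij_betw h S T \<Longrightarrow> sum_mats n (\<lambda>x. f (h x)) S = sum_mats n f T"
  unfolding sum_mats_def by (simp add: sum.reindex_bij_betw[of h S T "\<lambda>x. f x $$ _"])

lemma mat_mult_index:
  assumes "A \<in> carrier_mat n n" "B \<in> carrier_mat n n" "i < n" "j < n"
  shows "(A * B) $$ (i, j) = (\<Sum>k<n. A $$ (i, k) * B $$ (k, j))"
  using assms by (auto simp: scalar_prod_def lessThan_atLeast0 intro!: sum.cong)

lemma mult_sum_mats:
  assumes A: "A \<in> carrier_mat n n" and f: "\<And>x. x \<in> S \<Longrightarrow> f x \<in> carrier_mat n n"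
  shows "A * sum_mats n f S = sum_mats n (\<lambda>x. A * f x) S"
proof (rule eq_matI)
  fix i j assume ij: "i < dim_row (sum_mats n (\<lambda>x. A * f x) S)"
    "j < dim_col (sum_mats n (\<lambda>x. A * f x) S)"
  hence i: "i < n" and j: "j < n" by (auto simp: sum_mats_def)
  have "(A * sum_mats n f S) $$ (i, j) = (\<Sum>k<n. \<Sum>x\<in>S. A $$ (i, k) * f x $$ (k, j))"
    using i j A by (simp add: mat_mult_index[OF A sum_mats_carrier i j] del: index_mult_mat)
      (simp add: sum_mats_def sum_distrib_left)
  also have "\<dots> = (\<Sum>x\<in>S. (A * f x) $$ (i, j))"
    by (subst sum.swap) (simp add: mat_mult_index[OF A f i j] del: index_mult_mat)
  finally show "(A * sum_mats n f S) $$ (i, j) = sum_mats n (\<lambda>x. A * f x) S $$ (i, j)"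
    using i j by (simp add: sum_mats_def)
qed (use A in \<open>auto simp: sum_mats_def\<close>)

lemma sum_mats_mult:
  assumes A: "A \<in> carrier_mat n n" and f: "\<And>x. x \<in> S \<Longrightarrow> f x \<in> carrier_mat n n"
  shows "sum_mats n f S * A = sum_mats n (\<lambda>x. f x * A) S"
proof (rule eq_matI)
  fix i j assume ij: "i < dim_row (sum_mats n (\<lambda>x. f x * A) S)"
    "j < dim_col (sum_mats n (\<lambda>x. f x * A) S)"
  hence i: "i < n" and j: "j < n" by (auto simp: sum_mats_def)
  have "(sum_mats n f S * A) $$ (i, j) = (\<Sum>k<n. \<Sum>x\<in>S. f x $$ (i, k) * A $$ (k, j))"
    using i j A by (simp add: mat_mult_index[OF sum_mats_carrier A i j] del: index_mult_mat)
      (simp add: sum_mats_def sum_distrib_right)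
  also have "\<dots> = (\<Sum>x\<in>S. (f x * A) $$ (i, j))"
    by (subst sum.swap) (simp add: mat_mult_index[OF f A i j] del: index_mult_mat)
  finally show "(sum_mats n f S * A) $$ (i, j) = sum_mats n (\<lambda>x. f x * A) S $$ (i, j)"
    using i j by (simp add: sum_mats_def)
qed (use A in \<open>auto simp: sum_mats_def\<close>)

lemma mat_trace_sum_mats:
  assumes "\<And>x. x \<in> S \<Longrightarrow> f x \<in> carrier_mat n n"
  shows "mat_trace (sum_mats n f S) = (\<Sum>x\<in>S. mat_trace (f x))"
proof -
  have "mat_trace (sum_mats n f S) = (\<Sum>x\<in>S. \<Sum>i<n. f x $$ (i, i))"
    unfolding mat_trace_def sum_mats_def by (simp add: sum.swap[of _ S])
  thus ?thesis using assms by (fastforce simp: mat_trace_def intro: sum.cong)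
qed

lemma mat_trace_mult_comm:
  assumes A: "A \<in> carrier_mat n n" and B: "B \<in> carrier_mat n n"
  shows "mat_trace (A * B) = mat_trace (B * A)"
proof -
  have "mat_trace (A * B) = (\<Sum>i<n. \<Sum>k<n. A $$ (i, k) * B $$ (k, i))"
    using A B unfolding mat_trace_def
    by (intro sum.cong) (auto simp: mat_mult_index[OF A B] simp del: index_mult_mat(1))
  also have "\<dots> = (\<Sum>k<n. \<Sum>i<n. B $$ (k, i) * A $$ (i, k))"
    by (subst sum.swap) (simp add: mult.commute)
  also have "\<dots> = mat_trace (B * A)"
    using A B unfolding mat_trace_def
    by (intro sum.cong) (auto simp: mat_mult_index[OF B A] simp del: index_mult_mat(1))
  finally show ?thesis .
qed

lemma mat_trace_smult: "mat_trace (c \<cdot>\<^sub>m A) = c * mat_trace A"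
  if "A \<in> carrier_mat n n" for A :: "complex mat"
  using that unfolding mat_trace_def by (auto simp: sum_distrib_left intro!: sum.cong)

lemma mat_trace_one: "mat_trace (1\<^sub>m n) = of_nat n"
  unfolding mat_trace_def by simp

section \<open>Subspaces and adapted bases\<close>

text \<open>Unfolds the locale predicate on vector spaces that defines irreducibility into the usual
  closure conditions.\<close>

lemma subspaceI:
  assumes "W \<subseteq> carrier_vec n" "0\<^sub>v n \<in> W"
    and "\<And>v w. v \<in> W \<Longrightarrow> w \<in> W \<Longrightarrow> v + w \<in> W" "\<And>c v. v \<in> W \<Longrightarrow> c \<cdot>\<^sub>v v \<in> W"
  shows "VectorSpace.subspace class_ring W (module_vec TYPE(complex) n)"
proof -
  interpret vec_space "TYPE(complex)" n .
  show ?thesis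
    unfolding VectorSpace.subspace_def submodule_def
    using assms vec_vs vec_module by (auto simp: module_vec_simps class_field_def)
qed

lemma mult_mat_zero_vec:
  "A \<in> carrier_mat n n \<Longrightarrow> A *\<^sub>v 0\<^sub>v n = (0\<^sub>v n :: complex vec)"
  by (intro eq_vecI) auto

lemma mult_mat_unit_vec:
  assumes "A \<in> carrier_mat n n" "j < n"
  shows "A *\<^sub>v unit_vec n j = (col A j :: complex vec)"
  using assms by (intro eq_vecI) auto

lemma eq_mat_by_action:
  assumes A: "A \<in> carrier_mat n n" and B: "B \<in> carrier_mat n n"
    and eq: "\<And>v. v \<in> carrier_vec n \<Longrightarrow> A *\<^sub>v v = B *\<^sub>v v"
  shows "A = (B :: complex mat)"
proof (rule eq_matI)
  fix i j assume ij: "i < dim_row B" "j < dim_col B"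
  have "col A j = col B j"
    using eq[of "unit_vec n j"] ij A B by (simp add: mult_mat_unit_vec)
  hence "col A j $ i = col B j $ i" by simp
  thus "A $$ (i, j) = B $$ (i, j)" using ij A B by simp
qed (use A B in auto)

text \<open>A vector of \<open>S\<close> outside the span of \<open>U\<close> could be added to \<open>U\<close>, against maximality.\<close>

lemma (in vectorspace) subset_span_maximal_lin_indpt:
  assumes S: "S \<subseteq> carrier V" and U: "maximal U (\<lambda>T. T \<subseteq> S \<and> lin_indpt T)"
  shows "S \<subseteq> span U"
proof
  fix v assume v: "v \<in> S"
  have U': "U \<subseteq> S" "lin_indpt U" using U unfolding maximal_def by auto
  show "v \<in> span U"
  proof (cases "v \<in> U")
    case True
    thus ?thesis using in_own_span[of U] U' S by auto
  next
    case False
    have "lin_dep (U \<union> {v})"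
      using U v False unfolding maximal_def by (metis Un_upper1 UnI2 insert_subset insert_is_Un
          singletonI sup.bounded_iff empty_subsetI)
    thus ?thesis using lin_dep_iff_in_span[of U v] U' S v False by auto
  qed
qed

text \<open>A basis \<open>P\<close> of the whole space whose first \<open>k\<close> columns form a basis of \<open>W\<close>, together with the
  inverse \<open>Q\<close> that computes coordinates. The last two properties are what makes the matrices of
  operators preserving \<open>W\<close> block triangular in this basis.\<close>

lemma adapted_basis:
  assumes W: "VectorSpace.subspace class_ring W (module_vec TYPE(complex) n)"
    and W0: "W \<noteq> {0\<^sub>v n}" and W1: "W \<noteq> carrier_vec n"
  obtains k P Q where "0 < k" "k < n" "P \<in> carrier_mat n n" "Q \<in> carrier_mat n n"
    "P * Q = 1\<^sub>m n" "Q * P = 1\<^sub>m n"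
    "\<And>j. j < k \<Longrightarrow> col P j \<in> W"
    "\<And>w i. w \<in> W \<Longrightarrow> k \<le> i \<Longrightarrow> i < n \<Longrightarrow> (Q *\<^sub>v w) $ i = 0"
proof -
  interpret vec_space "TYPE(complex)" n .
  have sub: "submodule class_ring W V" using W by (simp add: VectorSpace.subspace_def)
  have Wc: "W \<subseteq> carrier_vec n" using submodule.subset[OF sub] by simp
  have li_card: "finite A \<and> card A \<le> n" if "A \<subseteq> carrier_vec n" "lin_indpt A" for A
    using li_le_dim[OF fin_dim, of A] that dim_is_n by simp
  have li0: "lin_indpt {}" unfolding lin_dep_def by auto
  have "\<exists>B. finite B \<and> maximal B (\<lambda>T. T \<subseteq> W \<and> lin_indpt T)"
    by (rule maximal_exists[where N = n and B = "{}"]) (use li_card Wc li0 in auto)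
  then obtain B where B: "finite B" "maximal B (\<lambda>T. T \<subseteq> W \<and> lin_indpt T)" by blast
  hence BW: "B \<subseteq> W" "lin_indpt B" unfolding maximal_def by auto
  have WB: "W \<subseteq> span B" using subset_span_maximal_lin_indpt[OF _ B(2)] Wc by simp
  have BW': "span B \<subseteq> W" using span_is_subset[OF BW(1) sub] .
  \<comment> \<open>Extending \<open>B\<close> inside the finite spanning set \<open>S\<close> gives a basis of the whole space.\<close>
  define S where "S = B \<union> set (unit_vecs n)"
  have Sc: "S \<subseteq> carrier_vec n" using BW Wc unit_vecs_carrier by (auto simp: S_def)
  have "\<exists>C. finite C \<and> maximal C (\<lambda>T. T \<subseteq> S \<and> lin_indpt T) \<and> B \<subseteq> C"
    by (rule maximal_exists_superset[where S = S]) (use B(1) BW in \<open>auto simp: S_def\<close>)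
  then obtain C where C: "finite C" "maximal C (\<lambda>T. T \<subseteq> S \<and> lin_indpt T)" "B \<subseteq> C" by blast
  hence CS: "C \<subseteq> S" "lin_indpt C" unfolding maximal_def by auto
  have "S \<subseteq> span C" using subset_span_maximal_lin_indpt[OF _ C(2)] Sc by simp
  hence "set (unit_vecs n) \<subseteq> span C" by (auto simp: S_def)
  moreover have "submodule class_ring (span C) V"
    using span_is_submodule[of C] CS Sc by simp
  ultimately have "span (set (unit_vecs n)) \<subseteq> span C"
    using span_is_subset by blast
  hence genC: "span C = carrier_vec n"
    using span_unit_vecs_is_carrier span_is_subset2[of C] CS Sc by auto
  have "basis C" using genC CS Sc unfolding basis_def by auto
  hence cardC: "card C = n" using dim_basis[OF C(1)] dim_is_n by simp
  obtain xs where xs: "set xs = B" "distinct xs" using finite_distinct_list[OF B(1)] by blast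
  obtain ys where ys: "set ys = C - B" "distinct ys"
    using finite_distinct_list[of "C - B"] C(1) by blast
  define zs where "zs = xs @ ys"
  have zs: "set zs = C" "distinct zs"
    using xs ys C(3) by (auto simp: zs_def)
  have len: "length zs = n" using distinct_card[OF zs(2)] zs(1) cardC by simp
  note zs = zs len
  define k where "k = length xs"
  define P where "P = mat_of_cols n zs"
  have P: "P \<in> carrier_mat n n" using mat_of_cols_carrier(1)[of n zs] len by (simp add: P_def)
  have cols: "cols P = zs" unfolding P_def using zs CS Sc by (intro cols_mat_of_cols) auto
  have "rank P = n" using lin_indpt_full_rank[OF P] cols zs CS by simp
  hence "det P \<noteq> 0" using det_rank_iff[OF P] by simp
  from det_non_zero_imp_unit[OF P this, of "()"] obtain Q where Q: "Q \<in> carrier_mat n n"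
    "P * Q = 1\<^sub>m n" "Q * P = 1\<^sub>m n" by (auto simp: Units_def ring_mat_simps)
  have colP: "col P j = zs ! j" if "j < n" for j
    using that cols P by (metis cols_nth carrier_matD(2))
  have kn: "k \<le> n" using zs by (simp add: zs_def k_def)
  have colW: "col P j \<in> W" if "j < k" for j
    using that kn colP[of j] BW xs by (auto simp: zs_def k_def nth_append)
  have Qw: "(Q *\<^sub>v w) $ i = 0" if w: "w \<in> W" and i: "k \<le> i" "i < n" for w i
  proof -
    \<comment> \<open>Coordinate \<open>i\<close> vanishes on the basis \<open>B\<close>, hence on its span.\<close>
    define K where "K = {v \<in> carrier_vec n. (Q *\<^sub>v v) $ i = 0}"
    have "VectorSpace.subspace class_ring K V"
      by (rule subspaceI) (use Q(1) i in \<open>auto simp: K_def mult_add_distrib_mat_vec[OF Q(1)]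
          mult_mat_vec[OF Q(1)] mult_mat_zero_vec[OF Q(1)] simp del: index_mult_mat_vec\<close>)
    hence K: "submodule class_ring K V" by (simp add: VectorSpace.subspace_def)
    have "B \<subseteq> K"
    proof
      fix b assume b: "b \<in> B"
      then obtain j where j: "j < k" "b = zs ! j"
        using xs by (auto simp: in_set_conv_nth zs_def k_def nth_append)
      have "Q *\<^sub>v b = col (Q * P) j"
        using j kn colP[of j] by (simp add: col_mult2[OF Q(1) P])
      also have "\<dots> = unit_vec n j" using Q j kn by simp
      finally show "b \<in> K" using j i kn b BW Wc by (auto simp: K_def)
    qed
    hence "span B \<subseteq> K" using span_is_subset[OF _ K] by simp
    thus ?thesis using w WB by (auto simp: K_def)
  qed
  have "k \<noteq> 0"
  proof
    assume "k = 0"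
    hence "B = {}" using xs by (simp add: k_def)
    hence "W \<subseteq> {0\<^sub>v n}" using WB span_empty by simp
    moreover have "0\<^sub>v n \<in> W" using submodule.zero_closed[OF sub] by simp
    ultimately show False using W0 by auto
  qed
  moreover have "k \<noteq> n"
  proof
    assume "k = n"
    hence "ys = []" using zs by (simp add: zs_def k_def)
    hence "B = C" using xs zs by (simp add: zs_def)
    thus False using BW' genC Wc W1 by auto
  qed
  ultimately show thesis using that[of k P Q] kn P Q colW Qw by force
qed


section \<open>Block triangular matrices\<close>

definition upper_block :: "nat \<Rightarrow> complex mat \<Rightarrow> complex mat" where
  "upper_block k A = mat k k (\<lambda>(i, j). A $$ (i, j))"

definition lower_block :: "nat \<Rightarrow> nat \<Rightarrow> complex mat \<Rightarrow> complex mat" where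
  "lower_block n k A = mat (n - k) (n - k) (\<lambda>(i, j). A $$ (i + k, j + k))"

lemma sum_split_at:
  fixes f :: "nat \<Rightarrow> complex"
  assumes "k \<le> n"
  shows "(\<Sum>i<n. f i) = (\<Sum>i<k. f i) + (\<Sum>i<n - k. f (i + k))"
  using sum.atLeastLessThan_concat[of 0 k n f] assms
    sum.shift_bounds_nat_ivl[of f 0 k "n - k"] by (simp add: lessThan_atLeast0)

text \<open>Passing to a diagonal block is multiplicative on block upper triangular matrices. For the
  representations below this is the passage to an invariant subspace and to its quotient.\<close>

lemma block_mult:
  assumes A: "A \<in> carrier_mat n n" and B: "B \<in> carrier_mat n n" and k: "k \<le> n"
    and A0: "\<And>i j. k \<le> i \<Longrightarrow> i < n \<Longrightarrow> j < k \<Longrightarrow> A $$ (i, j) = 0"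
    and B0: "\<And>i j. k \<le> i \<Longrightarrow> i < n \<Longrightarrow> j < k \<Longrightarrow> B $$ (i, j) = 0"
  shows "upper_block k (A * B) = upper_block k A * upper_block k B"
    and "lower_block n k (A * B) = lower_block n k A * lower_block n k B"
proof -
  have u: "upper_block k C \<in> carrier_mat k k" for C by (simp add: upper_block_def)
  have l: "lower_block n k C \<in> carrier_mat (n - k) (n - k)" for C by (simp add: lower_block_def)
  show "upper_block k (A * B) = upper_block k A * upper_block k B"
  proof (rule eq_matI)
    fix i j assume "i < dim_row (upper_block k A * upper_block k B)"
      "j < dim_col (upper_block k A * upper_block k B)"
    hence ij: "i < k" "j < k" by (auto simp: upper_block_def)
    have "(A * B) $$ (i, j) = (\<Sum>l<k. A $$ (i, l) * B $$ (l, j))"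
      using ij k by (simp add: mat_mult_index[OF A B] sum_split_at[OF k] B0 del: index_mult_mat)
    thus "upper_block k (A * B) $$ (i, j) = (upper_block k A * upper_block k B) $$ (i, j)"
      unfolding mat_mult_index[OF u u ij] using ij by (simp add: upper_block_def del: index_mult_mat)
  qed (auto simp: upper_block_def)
  show "lower_block n k (A * B) = lower_block n k A * lower_block n k B"
  proof (rule eq_matI)
    fix i j assume "i < dim_row (lower_block n k A * lower_block n k B)"
      "j < dim_col (lower_block n k A * lower_block n k B)"
    hence ij: "i < n - k" "j < n - k" by (auto simp: lower_block_def)
    hence "(A * B) $$ (i + k, j + k) = (\<Sum>l<n - k. A $$ (i + k, l + k) * B $$ (l + k, j + k))"
      using k by (simp add: mat_mult_index[OF A B] sum_split_at[OF k] A0 del: index_mult_mat)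
    thus "lower_block n k (A * B) $$ (i, j) = (lower_block n k A * lower_block n k B) $$ (i, j)"
      unfolding mat_mult_index[OF l l ij] using ij by (simp add: lower_block_def del: index_mult_mat)
  qed (auto simp: lower_block_def)
qed

lemma mat_trace_blocks:
  assumes "A \<in> carrier_mat n n" "k \<le> n"
  shows "mat_trace A = mat_trace (upper_block k A) + mat_trace (lower_block n k A)"
  using assms by (simp add: mat_trace_def upper_block_def lower_block_def sum_split_at[of k n])

section \<open>Representations and invariant subspaces\<close>

text \<open>The matrices are invertible because \<open>\<rho>(x\<inverse>)\<close> is inverse to \<open>\<rho>(x)\<close>.\<close>

lemma representationI:
  assumes "Group.group G"
    and "\<And>x. x \<in> carrier G \<Longrightarrow> \<rho> x \<in> carrier_mat n n"
    and "\<rho> \<one>\<^bsub>G\<^esub> = 1\<^sub>m n"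
    and "\<And>x y. x \<in> carrier G \<Longrightarrow> y \<in> carrier G \<Longrightarrow> \<rho> (x \<otimes>\<^bsub>G\<^esub> y) = \<rho> x * \<rho> y"
  shows "representation G n \<rho>"
proof -
  interpret group G by fact
  have "\<rho> x \<in> Units (ring_mat TYPE(complex) n ())" if x: "x \<in> carrier G" for x
    using assms(4)[of x "inv\<^bsub>G\<^esub> x"] assms(4)[of "inv\<^bsub>G\<^esub> x" x] assms(2)[of x]
      assms(2)[of "inv\<^bsub>G\<^esub> x"] assms(3) x
    by (auto simp: Units_def ring_mat_simps intro!: bexI[of _ "\<rho> (inv\<^bsub>G\<^esub> x)"])
  thus ?thesis
    using assms(4) by (auto simp: representation_def hom_def units_of_def ring_mat_simps)
qed

context group
begin

context
  fixes n :: nat and \<rho> :: "'a \<Rightarrow> complex mat"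
  assumes rep: "representation G n \<rho>"
begin

lemma rep_carrier [simp]: "x \<in> carrier G \<Longrightarrow> \<rho> x \<in> carrier_mat n n"
  using rep by (auto simp: representation_def hom_def units_of_def Units_def ring_mat_simps)

lemma rep_mult: "x \<in> carrier G \<Longrightarrow> y \<in> carrier G \<Longrightarrow> \<rho> (x \<otimes> y) = \<rho> x * \<rho> y"
  using rep by (auto simp: representation_def hom_def units_of_def ring_mat_simps)

lemma rep_one: "\<rho> \<one> = 1\<^sub>m n"
proof -
  have "\<rho> \<one> \<in> Units (ring_mat TYPE(complex) n ())"
    using rep by (auto simp: representation_def hom_def units_of_def)
  then obtain B where B: "B \<in> carrier_mat n n" "B * \<rho> \<one> = 1\<^sub>m n"
    by (auto simp: Units_def ring_mat_simps)
  have "\<rho> \<one> = (B * \<rho> \<one>) * \<rho> \<one>"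
    using B left_mult_one_mat[OF rep_carrier[OF one_closed]] by simp
  also have "\<dots> = B * (\<rho> \<one> * \<rho> \<one>)"
    by (rule assoc_mult_mat[OF B(1)]) (rule rep_carrier[OF one_closed])+
  also have "\<dots> = 1\<^sub>m n" using B rep_mult[of \<one> \<one>] by simp
  finally show ?thesis .
qed

lemma trace_rep_one: "mat_trace (\<rho> \<one>) = of_nat n"
  by (simp add: rep_one mat_trace_one)

lemma trace_rep_mult_comm:
  "x \<in> carrier G \<Longrightarrow> y \<in> carrier G \<Longrightarrow> mat_trace (\<rho> (x \<otimes> y)) = mat_trace (\<rho> (y \<otimes> x))"
  by (simp add: rep_mult mat_trace_mult_comm[of _ n])

end

lemma irreducible_representationD:
  assumes "irreducible_representation G n \<rho>"
  shows "representation G n \<rho>" "n > 0"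
    and "\<And>W. VectorSpace.subspace class_ring W (module_vec TYPE(complex) n) \<Longrightarrow>
      (\<And>x w. x \<in> carrier G \<Longrightarrow> w \<in> W \<Longrightarrow> \<rho> x *\<^sub>v w \<in> W) \<Longrightarrow> W = {0\<^sub>v n} \<or> W = carrier_vec n"
  using assms by (auto simp: irreducible_representation_def)

text \<open>Schur's lemma: an eigenspace of \<open>A\<close> is invariant, so it is the whole space.\<close>

lemma schur_scalar:
  assumes irr: "irreducible_representation G n \<rho>"
    and A: "A \<in> carrier_mat n n"
    and comm: "\<And>x. x \<in> carrier G \<Longrightarrow> A * \<rho> x = \<rho> x * A"
  shows "\<exists>c. A = c \<cdot>\<^sub>m 1\<^sub>m n"
proof -
  note rep = irreducible_representationD(1)[OF irr]
  obtain c where "c \<in> spectrum A"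
    using spectrum_non_empty[OF A irreducible_representationD(2)[OF irr]] by blast
  then obtain v where v: "v \<in> carrier_vec n" "v \<noteq> 0\<^sub>v n" "A *\<^sub>v v = c \<cdot>\<^sub>v v"
    using A by (auto simp: spectrum_def eigenvalue_def eigenvector_def)
  define W where "W = {w \<in> carrier_vec n. A *\<^sub>v w = c \<cdot>\<^sub>v w}"
  have "W = {0\<^sub>v n} \<or> W = carrier_vec n"
  proof (rule irreducible_representationD(3)[OF irr])
    show "VectorSpace.subspace class_ring W (module_vec TYPE(complex) n)"
      by (rule subspaceI)
        (use A in \<open>auto simp: W_def mult_add_distrib_mat_vec[OF A] mult_mat_vec[OF A]
          smult_add_distrib_vec[of _ n] smult_smult_assoc mult.commute\<close>)
  next
    fix x w assume x: "x \<in> carrier G" and w: "w \<in> W"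
    have "A *\<^sub>v (\<rho> x *\<^sub>v w) = (A * \<rho> x) *\<^sub>v w"
      using w x A rep_carrier[OF rep x] by (simp add: W_def)
    also have "\<dots> = \<rho> x *\<^sub>v (A *\<^sub>v w)"
      using w x A rep_carrier[OF rep x] by (simp add: W_def comm)
    also have "\<dots> = c \<cdot>\<^sub>v (\<rho> x *\<^sub>v w)"
      using w mult_mat_vec[OF rep_carrier[OF rep x]] by (simp add: W_def)
    finally show "\<rho> x *\<^sub>v w \<in> W" using rep_carrier[OF rep x] w by (simp add: W_def)
  qed
  moreover have "v \<in> W" using v by (simp add: W_def)
  ultimately have W: "W = carrier_vec n" using v by auto
  have "A = c \<cdot>\<^sub>m 1\<^sub>m n"
  proof (rule eq_mat_by_action[OF A])
    fix w :: "complex vec" assume w: "w \<in> carrier_vec n"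
    hence "A *\<^sub>v w = c \<cdot>\<^sub>v w" using W by (auto simp: W_def)
    also have "\<dots> = (c \<cdot>\<^sub>m 1\<^sub>m n) *\<^sub>v w"
      using w by (intro eq_vecI) auto
    finally show "A *\<^sub>v w = (c \<cdot>\<^sub>m 1\<^sub>m n) *\<^sub>v w" .
  qed simp
  thus ?thesis by blast
qed

text \<open>The vectors fixed by \<open>N\<close> form a subspace, which is invariant because \<open>N\<close> is normal. If it is
  everything, \<open>N\<close> acts trivially; if it is zero, so is \<open>\<Sum>m\<in>N. \<rho>(m)\<close>, whose image consists of
  fixed vectors.\<close>

lemma irreducible_trivial_or_sum_zero:
  assumes irr: "irreducible_representation G n \<rho>" and N: "N \<lhd> G"
  shows "(\<forall>m\<in>N. \<rho> m = 1\<^sub>m n) \<or> sum_mats n \<rho> N = 0\<^sub>m n n"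
proof -
  note rep = irreducible_representationD(1)[OF irr]
  interpret N: normal N G by fact
  have Nc: "m \<in> carrier G" if "m \<in> N" for m using that N.subset by blast
  define W where "W = {w \<in> carrier_vec n. \<forall>m\<in>N. \<rho> m *\<^sub>v w = w}"
  have "W = {0\<^sub>v n} \<or> W = carrier_vec n"
  proof (rule irreducible_representationD(3)[OF irr])
    show "VectorSpace.subspace class_ring W (module_vec TYPE(complex) n)"
      by (rule subspaceI)
        (auto simp: W_def mult_add_distrib_mat_vec[OF rep_carrier[OF rep Nc]]
          mult_mat_vec[OF rep_carrier[OF rep Nc]] rep_carrier[OF rep Nc]
          mult_mat_zero_vec[OF rep_carrier[OF rep Nc]])
  next
    fix x w assume x: "x \<in> carrier G" and w: "w \<in> W"
    have wc: "w \<in> carrier_vec n" using w by (simp add: W_def)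
    have "\<rho> m *\<^sub>v (\<rho> x *\<^sub>v w) = \<rho> x *\<^sub>v w" if m: "m \<in> N" for m
    proof -
      define m' where "m' = inv x \<otimes> m \<otimes> x"
      have m': "m' \<in> N" using N.inv_op_closed1[OF x m] by (simp add: m'_def)
      have eq: "m \<otimes> x = x \<otimes> m'" using x Nc[OF m] by (simp add: m'_def m_assoc[symmetric])
      have "\<rho> m *\<^sub>v (\<rho> x *\<^sub>v w) = \<rho> (m \<otimes> x) *\<^sub>v w"
        using wc rep_carrier[OF rep x] rep_carrier[OF rep Nc[OF m]]
        by (simp add: rep_mult[OF rep Nc[OF m] x])
      also have "\<dots> = \<rho> x *\<^sub>v (\<rho> m' *\<^sub>v w)"
        using wc rep_carrier[OF rep x] rep_carrier[OF rep Nc[OF m']]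
        by (simp add: eq rep_mult[OF rep x Nc[OF m']])
      also have "\<rho> m' *\<^sub>v w = w" using w m' by (simp add: W_def)
      finally show ?thesis .
    qed
    thus "\<rho> x *\<^sub>v w \<in> W" using rep_carrier[OF rep x] wc by (simp add: W_def)
  qed
  thus ?thesis
  proof
    assume W: "W = carrier_vec n"
    have "\<rho> m = 1\<^sub>m n" if m: "m \<in> N" for m
    proof (rule eq_mat_by_action[OF rep_carrier[OF rep Nc[OF m]]])
      fix v :: "complex vec" assume v: "v \<in> carrier_vec n"
      hence "v \<in> W" using W by simp
      thus "\<rho> m *\<^sub>v v = 1\<^sub>m n *\<^sub>v v" using v m by (simp add: W_def)
    qed simp
    thus ?thesis by blast
  next
    assume W: "W = {0\<^sub>v n}"
    let ?E = "sum_mats n \<rho> N"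
    have "\<rho> m * ?E = ?E" if m: "m \<in> N" for m
    proof -
      have "\<rho> m * ?E = sum_mats n (\<lambda>k. \<rho> m * \<rho> k) N"
        by (rule mult_sum_mats) (use Nc m rep in \<open>auto intro: rep_carrier\<close>)
      also have "\<dots> = sum_mats n (\<lambda>k. \<rho> (m \<otimes> k)) N"
        by (rule sum_mats_cong) (use Nc m rep in \<open>simp add: rep_mult\<close>)
      also have "\<dots> = ?E"
        by (rule sum_mats_reindex, rule bij_betwI[where g = "\<lambda>k. inv m \<otimes> k"])
          (use m Nc in \<open>auto simp: m_assoc[symmetric]\<close>)
      finally show ?thesis .
    qed
    moreover have "?E *\<^sub>v v \<in> carrier_vec n" if "v \<in> carrier_vec n" for v
      using that by (rule mult_mat_vec_carrier[OF sum_mats_carrier])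
    ultimately have EW: "?E *\<^sub>v v \<in> W" if "v \<in> carrier_vec n" for v
      using that
      by (simp add: W_def assoc_mult_mat_vec[OF rep_carrier[OF rep Nc] sum_mats_carrier that, symmetric])
    have "?E *\<^sub>v v = 0\<^sub>m n n *\<^sub>v v" if "v \<in> carrier_vec n" for v
      using that EW[OF that] W by (auto intro!: eq_vecI)
    hence "?E = 0\<^sub>m n n" by (intro eq_mat_by_action) auto
    thus ?thesis by blast
  qed
qed

section \<open>Irreducible characters\<close>

lemma IrrE:
  assumes "\<chi> \<in> Irr G"
  obtains n \<rho> where "irreducible_representation G n \<rho>" "n > 0" "representation G n \<rho>"
    "\<And>x. x \<in> carrier G \<Longrightarrow> \<chi> x = mat_trace (\<rho> x)" "\<chi> \<one> = of_nat n"
proof -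
  from assms obtain n \<rho> where irr: "irreducible_representation G n \<rho>" "\<chi> = character_of G \<rho>"
    by (auto simp: Irr_def)
  thus thesis using that[OF irr(1)] irreducible_representationD[OF irr(1)]
    by (simp add: character_of_def trace_rep_one)
qed

lemma Irr_conj_invariant:
  assumes \<chi>: "\<chi> \<in> Irr G" and x: "x \<in> carrier G" and g: "g \<in> carrier G"
  shows "\<chi> (x \<otimes> g \<otimes> inv x) = \<chi> g"
proof -
  obtain n \<rho> where rep: "representation G n \<rho>"
    and \<chi>: "\<And>x. x \<in> carrier G \<Longrightarrow> \<chi> x = mat_trace (\<rho> x)"
    using \<chi> by (elim IrrE) blast
  have "mat_trace (\<rho> (x \<otimes> g \<otimes> inv x)) = mat_trace (\<rho> (inv x \<otimes> (x \<otimes> g)))"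
    using x g by (intro trace_rep_mult_comm[OF rep]) auto
  thus ?thesis using x g by (simp add: \<chi> m_assoc[symmetric])
qed

text \<open>The sum of all \<open>\<rho>(x h x\<inverse>)\<close> commutes with the representation, so by Schur's lemma it is a
  scalar, which its trace determines. Multiplying by \<open>\<rho>(y)\<close> and taking traces gives the formula.\<close>

lemma Irr_sum_conjugates:
  assumes \<chi>: "\<chi> \<in> Irr G"
    and h: "h \<in> carrier G" and y: "y \<in> carrier G"
  shows "(\<Sum>x\<in>carrier G. \<chi> (x \<otimes> h \<otimes> inv x \<otimes> y)) = of_nat (card (carrier G)) * (\<chi> h * \<chi> y / \<chi> \<one>)"
proof -
  obtain n \<rho> where irr: "irreducible_representation G n \<rho>" and n: "n > 0"
    and rep: "representation G n \<rho>" and \<chi>_def: "\<And>x. x \<in> carrier G \<Longrightarrow> \<chi> x = mat_trace (\<rho> x)"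
    and \<chi>1: "\<chi> \<one> = of_nat n"
    using \<chi> by (elim IrrE) blast
  note rep_carrier [OF rep, simp]
  let ?S = "sum_mats n (\<lambda>x. \<rho> (x \<otimes> h \<otimes> inv x)) (carrier G)"
  have "?S * \<rho> z = \<rho> z * ?S" if z: "z \<in> carrier G" for z
  proof -
    have "\<rho> z * ?S = sum_mats n (\<lambda>x. \<rho> z * \<rho> (x \<otimes> h \<otimes> inv x)) (carrier G)"
      using z h by (intro mult_sum_mats) auto
    also have "\<dots> = sum_mats n (\<lambda>x. \<rho> ((z \<otimes> x) \<otimes> h \<otimes> inv (z \<otimes> x)) * \<rho> z) (carrier G)"
      using z h by (intro sum_mats_cong)
        (simp add: rep_mult[OF rep, symmetric] inv_mult_group m_assoc)
    also have "\<dots> = sum_mats n (\<lambda>x. \<rho> (x \<otimes> h \<otimes> inv x) * \<rho> z) (carrier G)"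
      by (rule sum_mats_reindex, rule bij_betwI[where g = "\<lambda>x. inv z \<otimes> x"])
        (use z in \<open>auto simp: m_assoc[symmetric]\<close>)
    also have "\<dots> = ?S * \<rho> z"
      using z h by (intro sum_mats_mult[symmetric]) auto
    finally show ?thesis by simp
  qed
  then obtain c where c: "?S = c \<cdot>\<^sub>m 1\<^sub>m n" using schur_scalar[OF irr sum_mats_carrier] by blast
  have "mat_trace ?S = (\<Sum>x\<in>carrier G. \<chi> (x \<otimes> h \<otimes> inv x))"
    using h by (subst mat_trace_sum_mats) (auto simp: \<chi>_def)
  also have "\<dots> = of_nat (card (carrier G)) * \<chi> h"
    using h by (simp add: Irr_conj_invariant[OF \<chi>])
  finally have "c * of_nat n = of_nat (card (carrier G)) * \<chi> h"
    by (simp add: c mat_trace_smult[of _ n] mat_trace_one)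
  hence c_eq: "c = of_nat (card (carrier G)) * \<chi> h / \<chi> \<one>" using n by (simp add: field_simps \<chi>1)
  have "(\<Sum>x\<in>carrier G. \<chi> (x \<otimes> h \<otimes> inv x \<otimes> y)) =
      (\<Sum>x\<in>carrier G. mat_trace (\<rho> (x \<otimes> h \<otimes> inv x) * \<rho> y))"
    using h y by (intro sum.cong) (auto simp: \<chi>_def rep_mult[OF rep])
  also have "\<dots> = mat_trace (sum_mats n (\<lambda>x. \<rho> (x \<otimes> h \<otimes> inv x) * \<rho> y) (carrier G))"
    using h y by (subst mat_trace_sum_mats) (auto intro!: mult_carrier_mat[where n = n])
  also have "\<dots> = mat_trace (?S * \<rho> y)"
    using h y by (subst sum_mats_mult) auto
  also have "\<dots> = c * \<chi> y"
    using mult_smult_assoc_mat[OF one_carrier_mat rep_carrier[OF rep y], of c]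
      left_mult_one_mat[OF rep_carrier[OF rep y]] mat_trace_smult[OF rep_carrier[OF rep y]]
    by (simp add: c \<chi>_def y)
  finally show ?thesis by (simp add: c_eq)
qed

text \<open>If \<open>\<rho>\<close> were trivial on \<open>N\<close>, then \<open>N\<close> would lie in the kernel of \<open>\<chi>\<close>. So \<open>\<Sum>m\<in>N. \<rho>(m) = 0\<close>,
  and it remains to multiply by \<open>\<rho>(g)\<close> and take traces.\<close>

lemma Irr_sum_coset:
  assumes \<chi>: "\<chi> \<in> Irr_over G N" and N: "N \<lhd> G" and g: "g \<in> carrier G"
  shows "(\<Sum>m\<in>N. \<chi> (g \<otimes> m)) = 0"
proof -
  have Irr: "\<chi> \<in> Irr G" and ker: "\<not> N \<subseteq> character_kernel G \<chi>"
    using \<chi> by (auto simp: Irr_over_def)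
  obtain n \<rho> where irr: "irreducible_representation G n \<rho>"
    and rep: "representation G n \<rho>" and \<chi>_def: "\<And>x. x \<in> carrier G \<Longrightarrow> \<chi> x = mat_trace (\<rho> x)"
    and \<chi>1: "\<chi> \<one> = of_nat n"
    using Irr by (elim IrrE) blast
  have Nc: "m \<in> carrier G" if "m \<in> N" for m
    using that N by (meson normal_imp_subgroup subgroup.mem_carrier)
  note rep_carrier [OF rep, simp]
  have "\<not> (\<forall>m\<in>N. \<rho> m = 1\<^sub>m n)"
    using ker Nc by (auto simp: character_kernel_def \<chi>_def[OF Nc] \<chi>1 mat_trace_one)
  hence E: "sum_mats n \<rho> N = 0\<^sub>m n n" using irreducible_trivial_or_sum_zero[OF irr N] by blast
  have "(\<Sum>m\<in>N. \<chi> (g \<otimes> m)) = (\<Sum>m\<in>N. mat_trace (\<rho> g * \<rho> m))"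
    using g Nc by (intro sum.cong) (auto simp: \<chi>_def rep_mult[OF rep])
  also have "\<dots> = mat_trace (\<rho> g * sum_mats n \<rho> N)"
    using g Nc by (subst mult_sum_mats, simp, simp, subst mat_trace_sum_mats)
      (auto intro!: mult_carrier_mat[where n = n])
  also have "\<dots> = 0" using rep_carrier[OF rep g] by (simp add: E mat_trace_def)
  finally show ?thesis .
qed

text \<open>The kernel condition is on the character only, but it makes the representation itself
  trivial on \<open>N\<close>: otherwise the values of \<open>\<chi>\<close> on \<open>N\<close> would sum to zero, while they are all equal to
  the degree. A representation trivial on \<open>N\<close> factors through the quotient, with the same
  invariant subspaces.\<close>

lemma Irr_deflate:
  assumes fin: "finite N" and \<chi>: "\<chi> \<in> Irr G" "\<chi> \<notin> Irr_over G N" and N: "N \<lhd> G"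
  obtains \<chi>' where "\<chi>' \<in> Irr (G Mod N)" "\<And>x. x \<in> carrier G \<Longrightarrow> \<chi> x = \<chi>' (N #> x)"
proof -
  interpret N: normal N G by fact
  have Nc: "m \<in> carrier G" if "m \<in> N" for m using that N.subset by blast
  obtain n \<rho> where irr: "irreducible_representation G n \<rho>" and n: "n > 0"
    and rep: "representation G n \<rho>" and \<chi>_def: "\<And>x. x \<in> carrier G \<Longrightarrow> \<chi> x = mat_trace (\<rho> x)"
    and \<chi>1: "\<chi> \<one> = of_nat n"
    using \<chi>(1) by (elim IrrE) blast
  note rep_carrier [OF rep, simp]
  have "sum_mats n \<rho> N \<noteq> 0\<^sub>m n n"
  proof
    assume 0: "sum_mats n \<rho> N = 0\<^sub>m n n"
    have "(\<Sum>m\<in>N. \<chi> m) = mat_trace (sum_mats n \<rho> N)"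
      using Nc by (subst mat_trace_sum_mats) (auto simp: \<chi>_def)
    also have "\<dots> = 0" by (simp add: 0 mat_trace_def)
    finally have "(\<Sum>m\<in>N. \<chi> m) = 0" .
    moreover have "\<chi> m = of_nat n" if "m \<in> N" for m
      using \<chi> that by (auto simp: Irr_over_def character_kernel_def \<chi>1)
    ultimately have "of_nat (card N) * (of_nat n :: complex) = 0" by simp
    thus False using n fin N.one_closed by auto
  qed
  hence triv: "\<rho> m = 1\<^sub>m n" if "m \<in> N" for m
    using irreducible_trivial_or_sum_zero[OF irr N] that by blast
  \<comment> \<open>Any representative of the coset will do, as \<open>\<rho>\<close> is constant on cosets of \<open>N\<close>.\<close>
  define \<sigma> where "\<sigma> X = \<rho> (SOME x. x \<in> X)" for X
  have \<sigma>: "\<sigma> (N #> x) = \<rho> x" if x: "x \<in> carrier G" for x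
  proof -
    have "x \<in> N #> x" using x N.subgroup_axioms by (rule rcos_self)
    hence "(SOME y. y \<in> N #> x) \<in> N #> x" by (rule someI)
    then obtain m where m: "m \<in> N" "(SOME y. y \<in> N #> x) = m \<otimes> x"
      by (auto simp: r_coset_def)
    show ?thesis using m x Nc[OF m(1)] left_mult_one_mat[OF rep_carrier[OF rep x]]
      by (simp add: \<sigma>_def rep_mult[OF rep] triv)
  qed
  have car: "carrier (G Mod N) = (\<lambda>x. N #> x) ` carrier G" by (rule carrier_FactGroup)
  have "N #> \<one> = N" using coset_join2[OF one_closed N.subgroup_axioms] by simp
  hence "\<sigma> N = 1\<^sub>m n" using \<sigma>[OF one_closed] rep_one[OF rep] by simp
  hence "representation (G Mod N) n \<sigma>"
    by (intro representationI N.factorgroup_is_group)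
      (auto simp: car \<sigma> N.rcos_sum rep_mult[OF rep])
  hence "irreducible_representation (G Mod N) n \<sigma>"
    using irr by (simp add: irreducible_representation_def car \<sigma>)
  hence "character_of (G Mod N) \<sigma> \<in> Irr (G Mod N)" by (auto simp: Irr_def)
  thus thesis using that by (auto simp: character_of_def car \<sigma> \<chi>_def)
qed


section \<open>Decomposing characters into irreducible ones\<close>

text \<open>In a basis adapted to \<open>W\<close> the representation is block triangular; its diagonal blocks
  \<open>\<sigma>\<close> and \<open>\<tau>\<close> are the representations on \<open>W\<close> and on the quotient by \<open>W\<close>.\<close>

lemma character_split:
  assumes rep: "representation G n \<rho>"
    and W: "VectorSpace.subspace class_ring W (module_vec TYPE(complex) n)"
    and inv: "\<And>x w. x \<in> carrier G \<Longrightarrow> w \<in> W \<Longrightarrow> \<rho> x *\<^sub>v w \<in> W"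
    and W0: "W \<noteq> {0\<^sub>v n}" and W1: "W \<noteq> carrier_vec n"
  obtains k \<sigma> \<tau> where "0 < k" "k < n" "representation G k \<sigma>" "representation G (n - k) \<tau>"
    "\<And>x. x \<in> carrier G \<Longrightarrow> mat_trace (\<rho> x) = mat_trace (\<sigma> x) + mat_trace (\<tau> x)"
proof -
  obtain k P Q where k: "0 < k" "k < n" and P: "P \<in> carrier_mat n n" and Q: "Q \<in> carrier_mat n n"
    and PQ: "P * Q = 1\<^sub>m n" and QP: "Q * P = 1\<^sub>m n"
    and PW: "\<And>j. j < k \<Longrightarrow> col P j \<in> W"
    and QW: "\<And>w i. w \<in> W \<Longrightarrow> k \<le> i \<Longrightarrow> i < n \<Longrightarrow> (Q *\<^sub>v w) $ i = 0"
    using adapted_basis[OF W W0 W1] by blast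
  define R where "R x = Q * (\<rho> x * P)" for x
  have \<rho>P: "\<rho> x * P \<in> carrier_mat n n" if "x \<in> carrier G" for x
    using rep_carrier[OF rep that] P by simp
  have R: "R x \<in> carrier_mat n n" if "x \<in> carrier G" for x
    using \<rho>P[OF that] Q by (simp add: R_def)
  have R0: "R x $$ (i, j) = 0" if x: "x \<in> carrier G" and ij: "k \<le> i" "i < n" "j < k" for x i j
  proof -
    have "R x $$ (i, j) = col (R x) j $ i" using R[OF x] ij k by simp
    also have "col (R x) j = Q *\<^sub>v (\<rho> x *\<^sub>v col P j)"
      using ij k \<rho>P[OF x] P by (simp add: R_def col_mult2[OF Q \<rho>P[OF x]]
          col_mult2[OF rep_carrier[OF rep x] P])
    also have "\<dots> $ i = 0" using QW inv[OF x PW] ij by blast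
    finally show ?thesis .
  qed
  have Rmult: "R (x \<otimes> y) = R x * R y" if x: "x \<in> carrier G" and y: "y \<in> carrier G" for x y
  proof -
    note c = rep_carrier[OF rep x] rep_carrier[OF rep y]
    have "R x * R y = Q * ((\<rho> x * P) * (Q * (\<rho> y * P)))"
      unfolding R_def by (rule assoc_mult_mat[OF Q \<rho>P[OF x] mult_carrier_mat[OF Q \<rho>P[OF y]]])
    also have "(\<rho> x * P) * (Q * (\<rho> y * P)) = \<rho> x * (P * (Q * (\<rho> y * P)))"
      by (rule assoc_mult_mat[OF c(1) P mult_carrier_mat[OF Q \<rho>P[OF y]]])
    also have "P * (Q * (\<rho> y * P)) = (P * Q) * (\<rho> y * P)"
      by (rule assoc_mult_mat[OF P Q \<rho>P[OF y], symmetric])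
    also have "\<dots> = \<rho> y * P" using left_mult_one_mat[OF \<rho>P[OF y]] by (simp add: PQ)
    also have "\<rho> x * (\<rho> y * P) = \<rho> (x \<otimes> y) * P"
      using assoc_mult_mat[OF c P] by (simp add: rep_mult[OF rep x y])
    finally show ?thesis by (simp add: R_def)
  qed
  have R1: "R \<one> = 1\<^sub>m n"
    using left_mult_one_mat[OF P] by (simp add: R_def rep_one[OF rep] QP)
  note blocks = block_mult[OF R R less_imp_le[OF k(2)] R0 R0]
  have "representation G k (\<lambda>x. upper_block k (R x))"
    by (intro representationI is_group)
      (auto simp: Rmult blocks R1, auto simp: upper_block_def k intro!: eq_matI,
        use k in auto)
  moreover have "representation G (n - k) (\<lambda>x. lower_block n k (R x))"
    by (intro representationI is_group)
      (auto simp: Rmult blocks R1, auto simp: lower_block_def k intro!: eq_matI)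
  moreover have "mat_trace (\<rho> x) = mat_trace (upper_block k (R x)) + mat_trace (lower_block n k (R x))"
    if x: "x \<in> carrier G" for x
  proof -
    note c = rep_carrier[OF rep x]
    have "mat_trace (R x) = mat_trace ((\<rho> x * P) * Q)"
      unfolding R_def by (rule mat_trace_mult_comm[OF Q \<rho>P[OF x]])
    also have "(\<rho> x * P) * Q = \<rho> x"
      using assoc_mult_mat[OF c P Q] right_mult_one_mat[OF c] by (simp add: PQ)
    finally show ?thesis using mat_trace_blocks[OF R[OF x], of k] k by simp
  qed
  ultimately show thesis using that[OF k] by blast
qed

text \<open>Induction along a composition series: the trace of a block triangular matrix depends only on
  its diagonal blocks, and these have smaller dimension.\<close>

lemma character_decomposition:
  assumes "representation G n \<rho>"
  shows "\<exists>cs. set cs \<subseteq> Irr G \<and> (\<forall>x\<in>carrier G. mat_trace (\<rho> x) = (\<Sum>\<chi>\<leftarrow>cs. \<chi> x))"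
  using assms
proof (induction n arbitrary: \<rho> rule: less_induct)
  case (less n)
  show ?case
  proof (cases "n = 0")
    case True
    have "mat_trace (\<rho> x) = 0" if "x \<in> carrier G" for x
      using rep_carrier[OF less.prems that] True by (simp add: mat_trace_def)
    thus ?thesis by (intro exI[of _ "[]"]) simp
  next
    case False
    show ?thesis
    proof (cases "irreducible_representation G n \<rho>")
      case True
      hence "character_of G \<rho> \<in> Irr G" by (auto simp: Irr_def)
      thus ?thesis by (intro exI[of _ "[character_of G \<rho>]"]) (simp add: character_of_def)
    next
      case reducible: False
      then obtain W where W: "VectorSpace.subspace class_ring W (module_vec TYPE(complex) n)"
        "\<And>x w. x \<in> carrier G \<Longrightarrow> w \<in> W \<Longrightarrow> \<rho> x *\<^sub>v w \<in> W"
        "W \<noteq> {0\<^sub>v n}" "W \<noteq> carrier_vec n"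
        using False less.prems by (auto simp: irreducible_representation_def)
      obtain k \<sigma> \<tau> where k: "0 < k" "k < n"
        and rep: "representation G k \<sigma>" "representation G (n - k) \<tau>"
        and tr: "\<And>x. x \<in> carrier G \<Longrightarrow> mat_trace (\<rho> x) = mat_trace (\<sigma> x) + mat_trace (\<tau> x)"
        using character_split[OF less.prems W] by blast
      obtain cs where cs: "set cs \<subseteq> Irr G" "\<forall>x\<in>carrier G. mat_trace (\<sigma> x) = (\<Sum>\<chi>\<leftarrow>cs. \<chi> x)"
        using less.IH[OF k(2) rep(1)] by blast
      obtain ds where ds: "set ds \<subseteq> Irr G" "\<forall>x\<in>carrier G. mat_trace (\<tau> x) = (\<Sum>\<chi>\<leftarrow>ds. \<chi> x)"
        using less.IH[OF _ rep(2)] k by auto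
      show ?thesis by (intro exI[of _ "cs @ ds"]) (use cs ds tr in auto)
    qed
  qed
qed

text \<open>The regular representation permutes a basis indexed by the group, and multiplication by
  \<open>x \<noteq> \<one>\<close> fixes no basis vector.\<close>

lemma regular_character_decomposition:
  assumes fin: "finite (carrier G)"
  obtains cs where "set cs \<subseteq> Irr G"
    "\<And>x. x \<in> carrier G \<Longrightarrow> (\<Sum>\<chi>\<leftarrow>cs. \<chi> x) = (if x = \<one> then of_nat (card (carrier G)) else 0)"
proof -
  define n where "n = card (carrier G)"
  obtain e where e: "bij_betw e {..<n} (carrier G)"
    using ex_bij_betw_nat_finite[OF fin] by (auto simp: n_def lessThan_atLeast0)
  have ec: "e i \<in> carrier G" if "i < n" for i using bij_betwE[OF e] that by auto
  have e_eq: "e i = e j \<longleftrightarrow> i = j" if "i < n" "j < n" for i j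
    using e that by (auto simp: bij_betw_def inj_on_def)
  define \<rho> :: "'a \<Rightarrow> complex mat"
    where "\<rho> x = mat n n (\<lambda>(i, j). if e i = x \<otimes> e j then 1 else 0)" for x
  have \<rho>: "\<rho> x \<in> carrier_mat n n" for x by (simp add: \<rho>_def)
  have "\<rho> (x \<otimes> y) = \<rho> x * \<rho> y" if x: "x \<in> carrier G" and y: "y \<in> carrier G" for x y
  proof (rule eq_matI)
    fix i j assume "i < dim_row (\<rho> x * \<rho> y)" "j < dim_col (\<rho> x * \<rho> y)"
    hence ij: "i < n" "j < n" by (auto simp: \<rho>_def)
    obtain l where l: "l < n" "e l = y \<otimes> e j"
      using e y ec[OF ij(2)]
      by (auto simp: bij_betw_def image_iff) (metis (no_types) imageE lessThan_iff m_closed)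
    have "(\<rho> x * \<rho> y) $$ (i, j) = (\<Sum>k<n. \<rho> x $$ (i, k) * \<rho> y $$ (k, j))"
      by (rule mat_mult_index[OF \<rho> \<rho> ij])
    also have "\<dots> = (\<Sum>k<n. if k = l then \<rho> x $$ (i, l) else 0)"
      using ij l by (intro sum.cong) (auto simp: \<rho>_def l(2)[symmetric] e_eq)
    also have "\<dots> = \<rho> (x \<otimes> y) $$ (i, j)"
      using ij l x y ec[OF ij(2)] by (simp add: \<rho>_def m_assoc)
    finally show "\<rho> (x \<otimes> y) $$ (i, j) = (\<rho> x * \<rho> y) $$ (i, j)" by simp
  qed (auto simp: \<rho>_def)
  moreover have "\<rho> \<one> = 1\<^sub>m n"
    by (rule eq_matI) (auto simp: \<rho>_def e_eq ec)
  ultimately have rep: "representation G n \<rho>"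
    using \<rho> by (intro representationI is_group) auto
  have tr: "mat_trace (\<rho> x) = (if x = \<one> then of_nat n else 0)" if x: "x \<in> carrier G" for x
  proof -
    have "mat_trace (\<rho> x) = (\<Sum>i<n. if e i = x \<otimes> e i then 1 else 0)"
      by (simp add: mat_trace_def \<rho>_def)
    also have "\<dots> = (\<Sum>i<n. if x = \<one> then 1 else 0)"
      using x ec by (intro sum.cong) (auto simp: r_cancel_one')
    finally show ?thesis by simp
  qed
  obtain cs where "set cs \<subseteq> Irr G" "\<forall>x\<in>carrier G. mat_trace (\<rho> x) = (\<Sum>\<chi>\<leftarrow>cs. \<chi> x)"
    using character_decomposition[OF rep] by blast
  thus thesis using that[of cs] tr unfolding n_def by metis
qed

lemma sum_sum_list_swap:
  "(\<Sum>x\<in>A. \<Sum>c\<leftarrow>cs. f c x) = (\<Sum>c\<leftarrow>cs. \<Sum>x\<in>A. f c x :: complex)"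
  by (induction cs) (simp_all add: sum.distrib)

text \<open>Evaluate the regular character at \<open>x g x\<inverse> h\<inverse>\<close> and sum over \<open>x\<close>: each conjugator contributes
  \<open>|G|\<close>, and the other \<open>x\<close> contribute \<open>0\<close>.\<close>

lemma count_conjugators:
  assumes fin: "finite (carrier G)"
  shows "\<exists>cs. set cs \<subseteq> Irr G \<and> (\<forall>g\<in>carrier G. \<forall>h\<in>carrier G.
    of_nat (card {x \<in> carrier G. x \<otimes> g \<otimes> inv x = h}) = (\<Sum>\<chi>\<leftarrow>cs. \<chi> g * \<chi> (inv h) / \<chi> \<one>))"
proof -
  let ?n = "of_nat (card (carrier G)) :: complex"
  obtain cs where cs: "set cs \<subseteq> Irr G"
    and reg: "\<And>x. x \<in> carrier G \<Longrightarrow> (\<Sum>\<chi>\<leftarrow>cs. \<chi> x) = (if x = \<one> then ?n else 0)"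
    using regular_character_decomposition[OF fin] by blast
  have n0: "?n \<noteq> 0" using fin by auto
  have "of_nat (card {x \<in> carrier G. x \<otimes> g \<otimes> inv x = h}) = (\<Sum>\<chi>\<leftarrow>cs. \<chi> g * \<chi> (inv h) / \<chi> \<one>)"
    if g: "g \<in> carrier G" and h: "h \<in> carrier G" for g h
  proof -
    have "?n * of_nat (card {x \<in> carrier G. x \<otimes> g \<otimes> inv x = h}) =
        (\<Sum>x\<in>carrier G. if x \<otimes> g \<otimes> inv x = h then ?n else 0)"
      using fin by (simp add: sum.If_cases Int_def)
    also have "\<dots> = (\<Sum>x\<in>carrier G. \<Sum>\<chi>\<leftarrow>cs. \<chi> (x \<otimes> g \<otimes> inv x \<otimes> inv h))"
    proof (rule sum.cong)
      fix x assume x: "x \<in> carrier G"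
      have "x \<otimes> g \<otimes> inv x \<otimes> inv h = \<one> \<longleftrightarrow> x \<otimes> g \<otimes> inv x = h"
        using x g h by (metis inv_closed inv_equality inv_inv m_closed r_inv)
      thus "(if x \<otimes> g \<otimes> inv x = h then ?n else 0) = (\<Sum>\<chi>\<leftarrow>cs. \<chi> (x \<otimes> g \<otimes> inv x \<otimes> inv h))"
        using x g h by (subst reg) auto
    qed simp
    also have "\<dots> = (\<Sum>\<chi>\<leftarrow>cs. ?n * (\<chi> g * \<chi> (inv h) / \<chi> \<one>))"
      unfolding sum_sum_list_swap
      using cs g h by (intro arg_cong[where f = sum_list] map_cong refl Irr_sum_conjugates) auto
    also have "\<dots> = ?n * (\<Sum>\<chi>\<leftarrow>cs. \<chi> g * \<chi> (inv h) / \<chi> \<one>)"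
      by (rule sum_list_const_mult)
    finally show ?thesis using n0 by simp
  qed
  thus ?thesis using cs by (intro exI[of _ cs]) simp
qed

text \<open>The hypothesis equates the numbers of elements conjugating \<open>g\<close> to \<open>h\<close> and \<open>g\<close> to \<open>g\<close>.
  The second is positive, as it counts \<open>\<one>\<close>.\<close>

lemma in_conjugacy_class_by_characters:
  assumes fin: "finite (carrier G)" and g: "g \<in> carrier G" and h: "h \<in> carrier G"
    and eq: "\<And>\<chi>. \<chi> \<in> Irr G \<Longrightarrow> \<chi> g * \<chi> (inv h) = \<chi> g * \<chi> (inv g)"
  shows "h \<in> conjugacy_class G g"
proof -
  let ?conj = "\<lambda>h. {x \<in> carrier G. x \<otimes> g \<otimes> inv x = h}"
  obtain cs where cs: "set cs \<subseteq> Irr G"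
    and count: "\<forall>g\<in>carrier G. \<forall>h\<in>carrier G.
      of_nat (card {x \<in> carrier G. x \<otimes> g \<otimes> inv x = h}) = (\<Sum>\<chi>\<leftarrow>cs. \<chi> g * \<chi> (inv h) / \<chi> \<one>)"
    using count_conjugators[OF fin] by (elim exE conjE)
  have "(\<Sum>\<chi>\<leftarrow>cs. \<chi> g * \<chi> (inv h) / \<chi> \<one>) = (\<Sum>\<chi>\<leftarrow>cs. \<chi> g * \<chi> (inv g) / \<chi> \<one>)"
    using cs eq by (intro arg_cong[where f = sum_list] map_cong refl) (metis subsetD)
  hence "(of_nat (card (?conj h)) :: complex) = of_nat (card (?conj g))"
    using count g h by simp
  hence "card (?conj h) = card (?conj g)" by simp
  moreover have "\<one> \<in> ?conj g" using g by simp
  moreover have "finite (?conj g)" using fin by simp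
  ultimately have "card (?conj h) \<noteq> 0" by (metis card_0_eq empty_iff)
  hence "?conj h \<noteq> {}" by (metis card.empty)
  thus ?thesis by (auto simp: conjugacy_class_def)
qed

end

section \<open>Classes of the form M - N\<close>

theorem theorem1:
  fixes G :: "('a, 'b) monoid_scheme" and N M :: "'a set" and g :: 'a
  assumes "Group.group G" and "finite (carrier G)"
    and "N \<lhd> G" and "M \<lhd> G" and "N \<subset> M"
    and "g \<in> M - N"
  shows "conjugacy_class G g = M - N \<longleftrightarrow>
    (\<forall>\<chi>\<in>Irr (G Mod N). \<exists>c. \<forall>X\<in>carrier (G\<lparr>carrier := M\<rparr> Mod N) - {N}. \<chi> X = c) \<and>
    (\<forall>\<chi>\<in>Irr_over G N. \<chi> g = 0)"
proof -
  interpret group G by fact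
  interpret N: normal N G by fact
  interpret M: normal M G by fact
  interpret Q: group "G Mod N" by (rule N.factorgroup_is_group)
  have g: "g \<in> carrier G" "g \<in> M" "g \<notin> N" using assms(6) M.subset by auto
  have fN: "finite N" using N.subset assms(2) finite_subset by blast
  have coset_N: "N #>\<^bsub>G\<^esub> x = N \<longleftrightarrow> x \<in> N" if "x \<in> carrier G" for x
    using that coset_join1[OF _ that N.subgroup_axioms] coset_join2[OF that N.subgroup_axioms] by blast
  have quot: "carrier (G\<lparr>carrier := M\<rparr> Mod N) - {N} = (\<lambda>x. N #>\<^bsub>G\<^esub> x) ` (M - N)"
  proof -
    have "carrier (G\<lparr>carrier := M\<rparr> Mod N) = (\<lambda>x. N #>\<^bsub>G\<^esub> x) ` M"
      by (auto simp: carrier_FactGroup r_coset_def)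
    moreover have "N #>\<^bsub>G\<^esub> x \<noteq> N \<longleftrightarrow> x \<notin> N" if "x \<in> M" for x
      using coset_N[of x] that M.subset by auto
    ultimately show ?thesis by auto
  qed
  have hom: "group_hom G (G Mod N) (\<lambda>x. N #>\<^bsub>G\<^esub> x)"
    by (intro group_hom.intro group_hom_axioms.intro is_group Q.is_group N.r_coset_hom_Mod)
  show ?thesis
  proof
    assume cl: "conjugacy_class G g = M - N"
    show "(\<forall>\<chi>\<in>Irr (G Mod N). \<exists>c. \<forall>X\<in>carrier (G\<lparr>carrier := M\<rparr> Mod N) - {N}. \<chi> X = c) \<and>
      (\<forall>\<chi>\<in>Irr_over G N. \<chi> g = 0)"
    proof (rule conjI; rule ballI)
      fix \<chi> assume \<chi>: "\<chi> \<in> Irr (G Mod N)"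
      have "\<chi> (N #>\<^bsub>G\<^esub> x) = \<chi> (N #>\<^bsub>G\<^esub> g)" if "x \<in> M - N" for x
      proof -
        have "x \<in> conjugacy_class G g" using that cl by simp
        then obtain y where y: "y \<in> carrier G" "x = y \<otimes>\<^bsub>G\<^esub> g \<otimes>\<^bsub>G\<^esub> inv\<^bsub>G\<^esub> y"
          unfolding conjugacy_class_def by blast
        show ?thesis
          using Q.Irr_conj_invariant[OF \<chi> group_hom.hom_closed[OF hom y(1)]
              group_hom.hom_closed[OF hom g(1)]] y g
          by (simp del: mult_FactGroup flip: group_hom.hom_mult[OF hom] group_hom.hom_inv[OF hom])
      qed
      thus "\<exists>c. \<forall>X\<in>carrier (G\<lparr>carrier := M\<rparr> Mod N) - {N}. \<chi> X = c"
        unfolding quot by blast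
    next
      fix \<chi> assume \<chi>: "\<chi> \<in> Irr_over G N"
      have "\<chi> (g \<otimes>\<^bsub>G\<^esub> m) = \<chi> g" if m: "m \<in> N" for m
      proof -
        have "g \<otimes>\<^bsub>G\<^esub> m \<in> M" using g m assms(5) by auto
        moreover have "g \<otimes>\<^bsub>G\<^esub> m \<notin> N"
        proof
          assume "g \<otimes>\<^bsub>G\<^esub> m \<in> N"
          hence "g \<otimes>\<^bsub>G\<^esub> m \<otimes>\<^bsub>G\<^esub> inv\<^bsub>G\<^esub> m \<in> N" using m by blast
          thus False using g m by (simp add: m_assoc)
        qed
        ultimately obtain y where y: "y \<in> carrier G" "g \<otimes>\<^bsub>G\<^esub> m = y \<otimes>\<^bsub>G\<^esub> g \<otimes>\<^bsub>G\<^esub> inv\<^bsub>G\<^esub> y"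
          using cl by (auto simp: conjugacy_class_def)
        thus ?thesis using Irr_conj_invariant[of \<chi> y g] \<chi> g by (simp add: Irr_over_def)
      qed
      hence "of_nat (card N) * \<chi> g = 0"
        using Irr_sum_coset[OF \<chi> assms(3) g(1)] by simp
      moreover have "card N \<noteq> 0"
        using fN subgroup.one_closed[OF N.subgroup_axioms] card_0_eq by blast
      ultimately show "\<chi> g = 0" by simp
    qed
  next
    assume A: "(\<forall>\<chi>\<in>Irr (G Mod N). \<exists>c. \<forall>X\<in>carrier (G\<lparr>carrier := M\<rparr> Mod N) - {N}. \<chi> X = c) \<and>
      (\<forall>\<chi>\<in>Irr_over G N. \<chi> g = 0)"
    have inv_MN: "inv\<^bsub>G\<^esub> h \<in> M - N" if "h \<in> M - N" for h
    proof -
      have h: "h \<in> carrier G" using that M.subset by blast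
      have "h \<in> N" if "inv\<^bsub>G\<^esub> h \<in> N"
        using subgroup.m_inv_closed[OF N.subgroup_axioms that] h by simp
      thus ?thesis using that subgroup.m_inv_closed[OF M.subgroup_axioms] by blast
    qed
    have "h \<in> conjugacy_class G g" if h: "h \<in> M - N" for h
    proof -
      have hc: "h \<in> carrier G" using h M.subset by auto
      have "\<chi> g * \<chi> (inv\<^bsub>G\<^esub> h) = \<chi> g * \<chi> (inv\<^bsub>G\<^esub> g)" if \<chi>: "\<chi> \<in> Irr G" for \<chi>
      proof (cases "\<chi> \<in> Irr_over G N")
        case True
        thus ?thesis using A by simp
      next
        case False
        obtain \<chi>' where \<chi>': "\<chi>' \<in> Irr (G Mod N)" "\<And>x. x \<in> carrier G \<Longrightarrow> \<chi> x = \<chi>' (N #>\<^bsub>G\<^esub> x)"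
          using Irr_deflate[OF fN \<chi> False assms(3)] by blast
        have "\<chi>' (N #>\<^bsub>G\<^esub> inv\<^bsub>G\<^esub> h) = \<chi>' (N #>\<^bsub>G\<^esub> inv\<^bsub>G\<^esub> g)"
        proof -
          obtain c where "\<forall>X\<in>(\<lambda>x. N #>\<^bsub>G\<^esub> x) ` (M - N). \<chi>' X = c"
            using A \<chi>'(1) unfolding quot by blast
          thus ?thesis using inv_MN[OF h] inv_MN[OF assms(6)] by simp
        qed
        thus ?thesis using \<chi>'(2) hc g by simp
      qed
      thus ?thesis by (rule in_conjugacy_class_by_characters[OF assms(2) g(1) hc])
    qed
    moreover have "conjugacy_class G g \<subseteq> M - N"
    proof
      fix h assume "h \<in> conjugacy_class G g"
      then obtain y where y: "y \<in> carrier G" "h = y \<otimes>\<^bsub>G\<^esub> g \<otimes>\<^bsub>G\<^esub> inv\<^bsub>G\<^esub> y"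
        by (auto simp: conjugacy_class_def)
      have "g = inv\<^bsub>G\<^esub> y \<otimes>\<^bsub>G\<^esub> h \<otimes>\<^bsub>G\<^esub> y"
        using y g by (simp add: m_assoc[symmetric]) (simp add: m_assoc)
      hence "h \<notin> N" using N.inv_op_closed1[OF y(1), of h] g(3) by metis
      thus "h \<in> M - N" using M.inv_op_closed2[OF y(1) g(2)] y(2) by simp
    qed
    ultimately show "conjugacy_class G g = M - N" by blast
  qed
qed

end
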